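(* Let $F = (f_1,\ldots,f_m)$ with $f_i\in\mathbb{R}[x_1,\ldots,x_n]_{\leq 2}$, let $M \in GL_n(\mathbb{R})$, and let $M\cdot F = (f_1(M^{-1}x),\ldots,f_m(M^{-1}x))$. If $(C,c)\in\mathcal{R}_F$, then $(M^{-T}CM^{-1},\, M^{-T}c)\in\mathcal{R}_{M\cdot F}$.
   Context: $\mathbb{R}[x_1,\ldots,x_n]_{\leq 2}$ is the set of real polynomials of degree at most $2$, and $\mathrm{Sym}_n(\mathbb{R})$ is the space of real symmetric $n\times n$ matrices. For a list $F=(f_1,\ldots,f_m)$ of real polynomials, $\mathcal{V}_{\mathbb{R}}(F) = \{x\in\mathbb{R}^n : f_1(x)=\cdots=f_m(x)=0\}$. $M^{-T}$ denotes the transpose of $M^{-1}$. SDP exact region: for a list $F=(f_1,\ldots,f_m)$ of polynomials in $\mathbb{R}[x_1,\ldots,x_n]_{\leq 2}$, write $f_i(x) = x^TA_ix + 2a_i^Tx + \alpha_i$ with $A_i \in \mathrm{Sym}_n(\mathbb{R})$, $a_i\in\mathbb{R}^n$, $\alpha_i\in\mathbb{R}$. For $C\in \mathrm{Sym}_n(\mathbb{R})$ and $\lambda\in\mathbb{R}^m$ put $H(\lambda) = C - \sum_{i=1}^m\lambda_iA_i$. Then $$\mathcal{R}_F = \Big\{(C,c)\in \mathrm{Sym}_n(\mathbb{R})\times\mathbb{R}^n : H(\lambda)\succ 0 \text{ and } c - \sum_{i=1}^m\lambda_ia_i + H(\lambda)x = 0 \text{ for some } x\in\mathcal{V}_{\mathbb{R}}(F),\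 \lambda\in\mathbb{R}^m\Big\},$$ where $\succ 0$ means positive definite. *)

theory Defs
  imports "HOL-Analysis.Analysis"
begin

text \<open>
  Real polynomials in n variables are identified with the polynomial functions on real ^ 'n they
  induce (a faithful identification, the field being infinite); the exponent vector of a monomial
  is a function 'n => nat.
\<close>

definition real_polys_deg_le :: "nat \<Rightarrow> (real ^ 'n \<Rightarrow> real) set" where
  "real_polys_deg_le d =
     {f. \<exists>coef :: ('n \<Rightarrow> nat) \<Rightarrow> real.
           f = (\<lambda>x. \<Sum>e | sum e UNIV \<le> d. coef e * (\<Prod>i\<in>UNIV. (x $ i) ^ e i))}"

definition sym_mats :: "(real ^ 'n ^ 'n) set" where
  "sym_mats = {A. transpose A = A}"

definition pos_def_mat :: "real ^ 'n ^ 'n \<Rightarrow> bool" where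
  "pos_def_mat A \<longleftrightarrow> A \<in> sym_mats \<and> (\<forall>x. x \<noteq> 0 \<longrightarrow> x \<bullet> (A *v x) > 0)"

definition quad_form_of ::
    "(real ^ 'n \<Rightarrow> real) \<Rightarrow> real ^ 'n ^ 'n \<Rightarrow> real ^ 'n \<Rightarrow> real \<Rightarrow> bool" where
  "quad_form_of f A a \<alpha> \<longleftrightarrow>
     A \<in> sym_mats \<and> (\<forall>x. f x = x \<bullet> (A *v x) + 2 * (a \<bullet> x) + \<alpha>)"

text \<open>
  For f in real_polys_deg_le 2 the representation exists and is unique (quad_form_of_exists and
  quad_form_of_unique below), so quad_mat and quad_vec are its coefficients; for other f they are
  unspecified.
\<close>

definition quad_mat :: "(real ^ 'n \<Rightarrow> real) \<Rightarrow> real ^ 'n ^ 'n" where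
  "quad_mat f = (THE A. \<exists>a \<alpha>. quad_form_of f A a \<alpha>)"

definition quad_vec :: "(real ^ 'n \<Rightarrow> real) \<Rightarrow> real ^ 'n" where
  "quad_vec f = (THE a. \<exists>A \<alpha>. quad_form_of f A a \<alpha>)"

definition real_variety :: "(real ^ 'n \<Rightarrow> real) list \<Rightarrow> (real ^ 'n) set" where
  "real_variety F = {x. \<forall>f\<in>set F. f x = 0}"

definition lagrange_hessian ::
    "(real ^ 'n \<Rightarrow> real) list \<Rightarrow> real ^ 'n ^ 'n \<Rightarrow> real list \<Rightarrow> real ^ 'n ^ 'n" where
  "lagrange_hessian F C l = C - (\<Sum>i<length F. (l ! i) *\<^sub>R quad_mat (F ! i))"

definition sdp_exact_region ::
    "(real ^ 'n \<Rightarrow> real) list \<Rightarrow> ((real ^ 'n ^ 'n) \<times> (real ^ 'n)) set" where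
  "sdp_exact_region F =
     {(C, c). C \<in> sym_mats \<and>
        (\<exists>x\<in>real_variety F. \<exists>l. length l = length F \<and>
           pos_def_mat (lagrange_hessian F C l) \<and>
           c - (\<Sum>i<length F. (l ! i) *\<^sub>R quad_vec (F ! i)) + lagrange_hessian F C l *v x = 0)}"

definition gl_act :: "real ^ 'n ^ 'n \<Rightarrow> (real ^ 'n \<Rightarrow> real) list \<Rightarrow> (real ^ 'n \<Rightarrow> real) list" where
  "gl_act M F = map (\<lambda>f x. f (matrix_inv M *v x)) F"


lemma finite_exponents: "finite {e :: 'n::finite \<Rightarrow> nat. sum e UNIV \<le> d}"
proof (rule finite_subset)
  show "{e :: 'n \<Rightarrow> nat. sum e UNIV \<le> d} \<subseteq> PiE UNIV (\<lambda>_. {..d})"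
  proof
    fix e :: "'n \<Rightarrow> nat" assume "e \<in> {e. sum e UNIV \<le> d}"
    then have s: "sum e UNIV \<le> d" by simp
    have "e i \<le> d" for i
      using member_le_sum[of i UNIV e] s by auto
    then show "e \<in> PiE UNIV (\<lambda>_. {..d})" by auto
  qed
qed (auto intro!: finite_PiE)

lemma quad_form_of_add:
  assumes "quad_form_of f A a \<alpha>" "quad_form_of g B b \<beta>"
  shows "quad_form_of (\<lambda>x. f x + g x) (A + B) (a + b) (\<alpha> + \<beta>)"
  using assms unfolding quad_form_of_def sym_mats_def
  by (auto simp: matrix_vector_mult_add_rdistrib inner_add_left inner_add_right algebra_simps
      transpose_def vec_eq_iff)

lemma quad_form_of_scale:
  assumes "quad_form_of f A a \<alpha>"
  shows "quad_form_of (\<lambda>x. r * f x) (r *\<^sub>R A) (r *\<^sub>R a) (r * \<alpha>)"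
  using assms unfolding quad_form_of_def sym_mats_def
  by (auto simp: scaleR_matrix_vector_assoc[symmetric] algebra_simps transpose_def vec_eq_iff)

lemma quad_form_of_sum:
  fixes g :: "'s \<Rightarrow> real ^ 'n \<Rightarrow> real"
  assumes "finite S" "\<And>s. s \<in> S \<Longrightarrow> \<exists>A a \<alpha>. quad_form_of (g s) A a \<alpha>"
  shows "\<exists>A a \<alpha>. quad_form_of (\<lambda>x. \<Sum>s\<in>S. g s x) A a \<alpha>"
  using assms
proof (induction S)
  case empty
  have "quad_form_of (\<lambda>x. 0) (0 :: real^'n^'n) 0 0"
    by (simp add: quad_form_of_def sym_mats_def transpose_def vec_eq_iff)
  then show ?case by auto
next
  case (insert s S)
  then obtain A a \<alpha> B b \<beta> where "quad_form_of (g s) A a \<alpha>"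
    "quad_form_of (\<lambda>x. \<Sum>s\<in>S. g s x) B b \<beta>"
    by (metis insertI1 insertI2)
  from quad_form_of_add[OF this] insert.hyps show ?case by auto
qed

lemma quad_form_of_prod2:
  "\<exists>A a \<alpha>. quad_form_of (\<lambda>x :: real ^ 'n. x $ i * x $ j) A a \<alpha>"
proof -
  define E :: "'n \<Rightarrow> 'n \<Rightarrow> real^'n^'n"
    where "E p q = (\<chi> k l. if k = p \<and> l = q then 1 else 0)" for p q
  define A where "A = (1/2) *\<^sub>R (E i j + E j i)"
  have "transpose (E p q) = E q p" for p q
    by (auto simp: E_def transpose_def vec_eq_iff)
  moreover have "transpose A = (1/2) *\<^sub>R (transpose (E i j) + transpose (E j i))"
    by (simp add: A_def transpose_def vec_eq_iff)
  ultimately have "A \<in> sym_mats"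
    by (simp add: A_def sym_mats_def add.commute)
  moreover have "x \<bullet> (A *v x) = x $ i * x $ j" for x
  proof -
    have E: "E p q *v x = (x $ q) *\<^sub>R axis p 1" for p q
    proof (rule vec_eq_iff[THEN iffD2, rule_format])
      fix k
      have "(E p q *v x) $ k = (\<Sum>l\<in>UNIV. if l = q then (if k = p then x $ l else 0) else 0)"
        unfolding matrix_vector_mult_def E_def vec_lambda_beta by (rule sum.cong) auto
      also have "\<dots> = ((x $ q) *\<^sub>R axis p 1) $ k"
        by (simp add: axis_def)
      finally show "(E p q *v x) $ k = ((x $ q) *\<^sub>R axis p 1) $ k" .
    qed
    have "A *v x = (1/2) *\<^sub>R (E i j *v x + E j i *v x)"
      by (simp add: A_def scaleR_matrix_vector_assoc[symmetric] matrix_vector_mult_add_rdistrib)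
    then show ?thesis by (simp add: E inner_add_right inner_axis)
  qed
  ultimately have "quad_form_of (\<lambda>x. x $ i * x $ j) A 0 0"
    by (simp add: quad_form_of_def)
  then show ?thesis by blast
qed

lemma quad_form_of_coord:
  "\<exists>A a \<alpha>. quad_form_of (\<lambda>x :: real ^ 'n. x $ i) A a \<alpha>"
proof -
  have "quad_form_of (\<lambda>x :: real ^ 'n. x $ i) 0 ((1/2) *\<^sub>R axis i 1) 0"
    by (simp add: quad_form_of_def sym_mats_def transpose_def vec_eq_iff inner_axis')
  then show ?thesis by blast
qed

lemma quad_form_of_const:
  "\<exists>A a \<alpha>. quad_form_of (\<lambda>x :: real ^ 'n. r) A a \<alpha>"
proof -
  have "quad_form_of (\<lambda>x :: real ^ 'n. r) 0 0 r"
    by (simp add: quad_form_of_def sym_mats_def transpose_def vec_eq_iff)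
  then show ?thesis by blast
qed

lemma monomial_reduce:
  fixes e :: "'n::finite \<Rightarrow> nat"
  assumes "sum e UNIV = Suc k"
  obtains i e' where "sum e' UNIV = k"
    and "\<And>x :: real ^ 'n. (\<Prod>i\<in>UNIV. (x $ i) ^ e i) = x $ i * (\<Prod>i\<in>UNIV. (x $ i) ^ e' i)"
proof -
  obtain i where i: "e i \<noteq> 0" using assms by (metis nat.distinct(1) sum.neutral)
  define e' where "e' = e(i := e i - 1)"
  have "sum e UNIV = e i + sum e (UNIV - {i})" "sum e' UNIV = e' i + sum e' (UNIV - {i})"
    by (simp_all add: sum.remove)
  moreover have "sum e' (UNIV - {i}) = sum e (UNIV - {i})"
    by (rule sum.cong) (auto simp: e'_def)
  ultimately have 1: "sum e' UNIV = k" using assms i by (simp add: e'_def)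
  have "(\<Prod>i\<in>UNIV. (x $ i) ^ e i) = x $ i * (\<Prod>i\<in>UNIV. (x $ i) ^ e' i)" for x :: "real ^ 'n"
  proof -
    have "(\<Prod>k\<in>UNIV. (x $ k) ^ e k) = (x $ i) ^ e i * (\<Prod>k\<in>UNIV - {i}. (x $ k) ^ e k)"
      "(\<Prod>k\<in>UNIV. (x $ k) ^ e' k) = (x $ i) ^ e' i * (\<Prod>k\<in>UNIV - {i}. (x $ k) ^ e' k)"
      by (simp_all add: prod.remove)
    moreover have "(\<Prod>k\<in>UNIV - {i}. (x $ k) ^ e' k) = (\<Prod>k\<in>UNIV - {i}. (x $ k) ^ e k)"
      by (rule prod.cong) (auto simp: e'_def)
    ultimately show ?thesis using i by (cases "e i") (auto simp: e'_def)
  qed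
  with 1 show ?thesis using that by blast
qed

lemma monomial_quad_form:
  fixes e :: "'n::finite \<Rightarrow> nat"
  assumes "sum e UNIV \<le> 2"
  shows "\<exists>A a \<alpha>. quad_form_of (\<lambda>x :: real ^ 'n. \<Prod>i\<in>UNIV. (x $ i) ^ e i) A a \<alpha>"
proof -
  have z: "(\<Prod>i\<in>UNIV. (x $ i) ^ g i) = 1" if "sum g UNIV = 0" for g and x :: "real ^ 'n"
    using that by simp
  consider "sum e UNIV = 0" | "sum e UNIV = Suc 0" | "sum e UNIV = Suc (Suc 0)"
    using assms by linarith
  then show ?thesis
  proof cases
    case 1
    show ?thesis unfolding z[OF 1] by (rule quad_form_of_const)
  next
    case 2
    then obtain i e' where e': "sum e' UNIV = 0"
      "\<And>x :: real ^ 'n. (\<Prod>i\<in>UNIV. (x $ i) ^ e i) = x $ i * (\<Prod>i\<in>UNIV. (x $ i) ^ e' i)"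
      by (rule monomial_reduce) blast
    show ?thesis unfolding e'(2) z[OF e'(1)] mult_1_right by (rule quad_form_of_coord)
  next
    case 3
    then obtain i e' where e': "sum e' UNIV = Suc 0"
      "\<And>x :: real ^ 'n. (\<Prod>i\<in>UNIV. (x $ i) ^ e i) = x $ i * (\<Prod>i\<in>UNIV. (x $ i) ^ e' i)"
      by (rule monomial_reduce) blast
    from e'(1) obtain j e'' where e'': "sum e'' UNIV = 0"
      "\<And>x :: real ^ 'n. (\<Prod>i\<in>UNIV. (x $ i) ^ e' i) = x $ j * (\<Prod>i\<in>UNIV. (x $ i) ^ e'' i)"
      by (rule monomial_reduce) blast
    show ?thesis unfolding e'(2) e''(2) z[OF e''(1)] mult_1_right by (rule quad_form_of_prod2)
  qed
qed

lemma quad_form_of_exists: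
  assumes "f \<in> real_polys_deg_le 2"
  shows "\<exists>A a \<alpha>. quad_form_of f A a \<alpha>"
proof -
  obtain coef where f: "f = (\<lambda>x. \<Sum>e | sum e UNIV \<le> 2. coef e * (\<Prod>i\<in>UNIV. (x $ i) ^ e i))"
    using assms by (auto simp: real_polys_deg_le_def)
  show ?thesis unfolding f
  proof (rule quad_form_of_sum[OF finite_exponents])
    fix e :: "'a \<Rightarrow> nat" assume "e \<in> {e. sum e UNIV \<le> 2}"
    then obtain A a \<alpha> where "quad_form_of (\<lambda>x. \<Prod>i\<in>UNIV. (x $ i) ^ e i) A a \<alpha>"
      using monomial_quad_form by blast
    from quad_form_of_scale[OF this]
    show "\<exists>A a \<alpha>. quad_form_of (\<lambda>x. coef e * (\<Prod>i\<in>UNIV. (x $ i) ^ e i)) A a \<alpha>"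
      by blast
  qed
qed

lemma quad_form_of_unique:
  assumes f: "quad_form_of f A a \<alpha>" and g: "quad_form_of f B b \<beta>"
  shows "A = B" "a = b" "\<alpha> = \<beta>"
proof -
  have A: "\<And>x. f x = x \<bullet> (A *v x) + 2 * (a \<bullet> x) + \<alpha>"
    and B: "\<And>x. f x = x \<bullet> (B *v x) + 2 * (b \<bullet> x) + \<beta>"
    and sA: "transpose A = A" and sB: "transpose B = B"
    using f g by (auto simp: quad_form_of_def sym_mats_def)
  show al: "\<alpha> = \<beta>" using A[of 0] B[of 0] by simp
  have neg: "- x \<bullet> (A *v - x) = x \<bullet> (A *v x)" for x and A :: "real^'a^'a"
    using matrix_vector_mult_diff_distrib[of A 0 x] by simp
  have "a \<bullet> x = b \<bullet> x" for x
    using A[of x] B[of x] A[of "- x"] B[of "- x"] neg[of x A] neg[of x B] by simp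
  then show ab: "a = b" by (metis vector_eq_rdot)
  have q: "x \<bullet> (A *v x) = x \<bullet> (B *v x)" for x
    using A[of x] B[of x] al ab by simp
  have pol: "(x + y) \<bullet> (A *v (x + y)) = x \<bullet> (A *v x) + y \<bullet> (A *v y) + 2 * (x \<bullet> (A *v y))"
    if "transpose A = A" for x y and A :: "real^'a^'a"
  proof -
    have "y \<bullet> (A *v x) = x \<bullet> (A *v y)"
      by (metis dot_lmul_matrix inner_commute that vector_transpose_matrix)
    then show ?thesis
      by (simp add: matrix_vector_right_distrib inner_add_left inner_add_right)
  qed
  have "x \<bullet> (A *v y) = x \<bullet> (B *v y)" for x y
    using pol[OF sA, of x y] pol[OF sB, of x y] q[of "x + y"] q[of x] q[of y] by simp
  then have "A *v y = B *v y" for y by (metis vector_eq_ldot)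
  then show "A = B" by (simp add: matrix_eq)
qed

lemma quad_coeffs_eq:
  assumes "quad_form_of f A a \<alpha>"
  shows "quad_mat f = A" "quad_vec f = a"
  unfolding quad_mat_def quad_vec_def
  using assms quad_form_of_unique by (blast intro: the_equality)+

lemma quad_form_of_quad_coeffs:
  assumes "f \<in> real_polys_deg_le 2"
  shows "\<exists>\<alpha>. quad_form_of f (quad_mat f) (quad_vec f) \<alpha>"
  using quad_form_of_exists[OF assms] quad_coeffs_eq by metis

end

theory Submission
  imports Defs
begin

text \<open>
  Substituting \<open>x = N y\<close> with \<open>N = M\<^sup>-\<^sup>1\<close> turns the data \<open>(A, a)\<close> of a
  quadratic polynomial into \<open>(N\<^sup>T A N, N\<^sup>T a)\<close> (lemma \<open>quad_form_of_substitution\<close>; uniqueness of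
  the coefficients makes this a statement about \<open>quad_mat\<close> and \<open>quad_vec\<close>). This transformation is
  linear in \<open>(A, a)\<close> and is also the one applied to the objective \<open>(C, c)\<close>, so
  with unchanged multipliers the Hessian \<open>H\<close> of the Lagrangian becomes \<open>N\<^sup>T H N\<close>, which stays
  positive definite because \<open>N\<close> is injective. If \<open>x\<close> is the point certifying
  \<open>(C, c) \<in> \<R>\<^sub>F\<close>, then \<open>M x\<close> lies on the variety of \<open>M \<cdot> F\<close>, and
  since \<open>N M x = x\<close> the stationarity equation at \<open>M x\<close> is \<open>N\<^sup>T\<close> times the one at \<open>x\<close>. Hence the
  same multipliers and the point \<open>M x\<close> certify membership for the transformed data.
\<close>

lemma transpose_congruence_in_sym_mats:
  fixes A :: "real ^ 'n ^ 'n" and N :: "real ^ 'm ^ 'n"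
  assumes "A \<in> sym_mats"
  shows "transpose N ** A ** N \<in> sym_mats"
  using assms by (simp add: sym_mats_def matrix_transpose_mul matrix_mul_assoc)

lemma inner_transpose_mult:
  fixes N :: "real ^ 'm ^ 'n"
  shows "x \<bullet> (transpose N *v y) = (N *v x) \<bullet> y"
  by (metis dot_lmul_matrix inner_commute transpose_matrix_vector)

lemma quadratic_form_congruence:
  fixes A :: "real ^ 'n ^ 'n" and N :: "real ^ 'm ^ 'n"
  shows "x \<bullet> ((transpose N ** A ** N) *v x) = (N *v x) \<bullet> (A *v (N *v x))"
  by (simp add: inner_transpose_mult del: transpose_matrix_vector flip: matrix_vector_mul_assoc)

lemma linear_congruence:
  fixes N :: "real ^ 'm ^ 'n"
  shows "linear (\<lambda>A. transpose N ** A ** N)"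
  by (rule linearI)
    (simp_all add: matrix_eq matrix_vector_right_distrib matrix_vector_mult_add_rdistrib
      matrix_vector_mult_scaleR del: transpose_matrix_vector
      flip: matrix_vector_mul_assoc scaleR_matrix_vector_assoc)

lemma pos_def_mat_congruence:
  assumes "pos_def_mat A" "invertible N"
  shows "pos_def_mat (transpose N ** A ** N)"
proof -
  have "N *v x \<noteq> 0" if "x \<noteq> 0" for x
    using assms(2) that by (metis invertible_def matrix_left_invertible_ker)
  then show ?thesis
    using assms(1)
    by (simp add: pos_def_mat_def quadratic_form_congruence transpose_congruence_in_sym_mats)
qed

text \<open>
  The linear term transforms by \<open>a \<bullet> N y = N\<^sup>T a \<bullet> y\<close>, which is why \<open>N\<^sup>T\<close> (and not \<open>N\<close>) acts on
  the vector part.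
\<close>

lemma quad_form_of_substitution:
  assumes "quad_form_of f A a \<alpha>"
  shows "quad_form_of (\<lambda>x. f (N *v x)) (transpose N ** A ** N) (transpose N *v a) \<alpha>"
proof -
  have "(transpose N *v a) \<bullet> x = a \<bullet> (N *v x)" for x
    using inner_transpose_mult[of x N a] by (simp only: inner_commute)
  then show ?thesis
    using assms unfolding quad_form_of_def quadratic_form_congruence
    by (simp add: transpose_congruence_in_sym_mats del: transpose_matrix_vector)
qed

lemma quad_coeffs_substitution:
  assumes "f \<in> real_polys_deg_le 2"
  shows "quad_mat (\<lambda>x. f (N *v x)) = transpose N ** quad_mat f ** N"
    and "quad_vec (\<lambda>x. f (N *v x)) = transpose N *v quad_vec f"
proof -
  obtain \<alpha> where "quad_form_of f (quad_mat f) (quad_vec f) \<alpha>"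
    using quad_form_of_quad_coeffs[OF assms] by blast
  note coeffs = quad_coeffs_eq[OF quad_form_of_substitution[OF this]]
  show "quad_mat (\<lambda>x. f (N *v x)) = transpose N ** quad_mat f ** N"
    by (rule coeffs(1))
  show "quad_vec (\<lambda>x. f (N *v x)) = transpose N *v quad_vec f"
    by (rule coeffs(2))
qed

lemma lagrange_hessian_gl_act:
  fixes M :: "real ^ 'n ^ 'n"
  assumes "set F \<subseteq> real_polys_deg_le 2"
  defines "N \<equiv> matrix_inv M"
  shows "lagrange_hessian (gl_act M F) (transpose N ** C ** N) l
         = transpose N ** lagrange_hessian F C l ** N"
proof -
  interpret congruence: linear "\<lambda>A. transpose N ** A ** N"
    by (rule linear_congruence)
  have "quad_mat (gl_act M F ! i) = transpose N ** quad_mat (F ! i) ** N" if "i < length F" for i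
    using assms(1) that by (auto simp: gl_act_def N_def intro!: quad_coeffs_substitution)
  then show ?thesis
    by (simp add: lagrange_hessian_def congruence.diff congruence.sum congruence.scale gl_act_def)
qed

lemma sum_quad_vec_gl_act:
  assumes "set F \<subseteq> real_polys_deg_le 2"
  shows "(\<Sum>i<length F. l ! i *\<^sub>R quad_vec (gl_act M F ! i))
         = transpose (matrix_inv M) *v (\<Sum>i<length F. l ! i *\<^sub>R quad_vec (F ! i))"
proof -
  interpret mult: linear "(*v) (transpose (matrix_inv M))"
    by (rule matrix_vector_mul_linear)
  have "quad_vec (gl_act M F ! i) = transpose (matrix_inv M) *v quad_vec (F ! i)"
    if "i < length F" for i
    using assms that
    by (auto simp: gl_act_def simp del: transpose_matrix_vector intro!: quad_coeffs_substitution)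
  then show ?thesis
    by (simp add: mult.sum mult.scale gl_act_def del: transpose_matrix_vector)
qed

theorem theorem3p2:
  fixes F :: "(real ^ 'n \<Rightarrow> real) list"
    and M C :: "real ^ 'n ^ 'n"
    and c :: "real ^ 'n"
  assumes "set F \<subseteq> real_polys_deg_le 2"
    and "invertible M"
    and "(C, c) \<in> sdp_exact_region F"
  shows "(transpose (matrix_inv M) ** C ** matrix_inv M, transpose (matrix_inv M) *v c)
           \<in> sdp_exact_region (gl_act M F)"
proof -
  define N where "N = matrix_inv M"
  have NM: "N ** M = mat 1" and MN: "M ** N = mat 1"
    using someI_ex[OF assms(2)[unfolded invertible_def]] by (simp_all add: N_def matrix_inv_def)
  have inv: "invertible N"
    using NM MN by (auto simp: invertible_def)
  obtain x l where C: "C \<in> sym_mats" and x: "x \<in> real_variety F" and l: "length l = length F"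
    and pd: "pos_def_mat (lagrange_hessian F C l)"
    and stat: "c - (\<Sum>i<length F. l ! i *\<^sub>R quad_vec (F ! i)) + lagrange_hessian F C l *v x = 0"
    using assms(3) by (auto simp: sdp_exact_region_def)
  let ?H = "lagrange_hessian F C l"
  let ?H' = "lagrange_hessian (gl_act M F) (transpose N ** C ** N) l"
  have H': "?H' = transpose N ** ?H ** N"
    unfolding N_def by (rule lagrange_hessian_gl_act[OF assms(1)])
  have NMx: "N *v (M *v x) = x"
    by (simp add: matrix_vector_mul_assoc NM)
  have len: "length (gl_act M F) = length F"
    by (simp add: gl_act_def)
  have var: "M *v x \<in> real_variety (gl_act M F)"
    using x NMx by (simp add: real_variety_def gl_act_def N_def)
  have pd': "pos_def_mat ?H'"
    unfolding H' using pd inv by (rule pos_def_mat_congruence)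
  have "transpose N *v c - (\<Sum>i<length F. l ! i *\<^sub>R quad_vec (gl_act M F ! i)) + ?H' *v (M *v x)
        = transpose N *v (c - (\<Sum>i<length F. l ! i *\<^sub>R quad_vec (F ! i)) + ?H *v x)"
    unfolding H' sum_quad_vec_gl_act[OF assms(1)] N_def[symmetric]
    by (simp add: NMx matrix_vector_right_distrib matrix_vector_mult_diff_distrib
        del: transpose_matrix_vector flip: matrix_vector_mul_assoc)
  also have "\<dots> = 0"
    by (simp add: stat)
  finally have stat': "transpose N *v c - (\<Sum>i<length (gl_act M F). l ! i *\<^sub>R quad_vec (gl_act M F ! i))
      + ?H' *v (M *v x) = 0"
    by (simp add: len)
  have "(transpose N ** C ** N, transpose N *v c) \<in> sdp_exact_region (gl_act M F)"
    unfolding sdp_exact_region_def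
    using transpose_congruence_in_sym_mats[OF C] var l len pd' stat' by auto
  then show ?thesis
    by (simp add: N_def)
qed

end
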